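(* If two finite simple graphs $A$ and $B$ are homotopic (as graphs), then their geometric Whitney realizations $\gamma(A)$ and $\gamma(B)$ are homotopic topological spaces (i.e. homotopy equivalent).
   Context: For a vertex $x$ of a finite simple graph, the unit sphere $S(x)$ is the subgraph induced by the neighbors of $x$. Contractible graphs are defined recursively: the one-point graph $K_1$ is contractible; a graph $B$ is contractible if there is a vertex $v$ such that both $S(v)$ and $B-v$ (the graph induced by the vertices other than $v$) are contractible. A homotopy step is either removing a vertex $v$ (with its edges) for which $S(v)$ is contractible, or the reverse: choosing a contractible (induced) subgraph $C$ of a graph and adding a new vertex $v$ connected exactly to all vertices of $C$. Two finite simple graphs are homotopic if one is obtained from the other, up to isomorphism, by finitely many homotopy steps. The geometric Whitney realization $\gamma(A)$ of a graph $A$ with vertices $x_1,\dots,x_n$ is the compact subset of $\mathbb{R}^n$ which is the union, over all complete subgraphs of $A$ with vertices $x_{k_0},\dots,x_{k_m}$, of the simplices spanned by the standard unit vectors $e_{k_0},\dots,e_{k_m}$ (the geometric realization of the clique complex of $A$). *)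

theory Defs
  imports
    "HOL-Analysis.Analysis"
    "Graph_Theory.Graph_Theory"
begin

text \<open>
  A finite simple graph is a value \<open>G\<close> of type \<open>'a pair_pre_digraph\<close> with \<open>pair_graph G\<close>: the vertex
  set is finite and the arcs form a symmetric irreflexive relation on it, an edge being given by its
  two orientations.
\<close>

definition induced :: "'a pair_pre_digraph \<Rightarrow> 'a set \<Rightarrow> 'a pair_pre_digraph" where
  "induced G W = \<lparr> pverts = W, parcs = {e \<in> parcs G. fst e \<in> W \<and> snd e \<in> W} \<rparr>"

lemma with_proj_induced: "with_proj (induced G W) = with_proj G \<restriction> W"
  by (simp add: induced_def with_proj_def induce_subgraph_def)

definition unit_sphere :: "'a pair_pre_digraph \<Rightarrow> 'a \<Rightarrow> 'a pair_pre_digraph" where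
  "unit_sphere G v = induced G {w \<in> pverts G. (v, w) \<in> parcs G}"

definition remove_vertex :: "'a pair_pre_digraph \<Rightarrow> 'a \<Rightarrow> 'a pair_pre_digraph" where
  "remove_vertex G v = induced G (pverts G - {v})"

definition cone_vertex :: "'a pair_pre_digraph \<Rightarrow> 'a set \<Rightarrow> 'a \<Rightarrow> 'a pair_pre_digraph" where
  "cone_vertex G W v =
     \<lparr> pverts = insert v (pverts G), parcs = parcs G \<union> {v} \<times> W \<union> W \<times> {v} \<rparr>"

inductive contractible_graph :: "'a pair_pre_digraph \<Rightarrow> bool" where
  one_point: "complete_digraph 1 (with_proj B) \<Longrightarrow> contractible_graph B"
| extension:
    "\<lbrakk> pair_graph B; v \<in> pverts B; contractible_graph (unit_sphere B v);
       contractible_graph (remove_vertex B v) \<rbrakk> \<Longrightarrow> contractible_graph B"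

inductive homotopy_step :: "'a pair_pre_digraph \<Rightarrow> 'a pair_pre_digraph \<Rightarrow> bool" where
  remove:
    "\<lbrakk> pair_graph G; v \<in> pverts G; contractible_graph (unit_sphere G v) \<rbrakk>
     \<Longrightarrow> homotopy_step G (remove_vertex G v)"
| add:
    "\<lbrakk> pair_graph G; W \<subseteq> pverts G; contractible_graph (induced G W); v \<notin> pverts G \<rbrakk>
     \<Longrightarrow> homotopy_step G (cone_vertex G W v)"

text \<open>
  The steps are carried out on isomorphic copies with vertices in \<open>nat\<close>: this type always has a fresh
  vertex to add, whereas the vertex types of \<open>A\<close> and \<open>B\<close> may be finite and may differ.
\<close>

definition graph_homotopic :: "'a pair_pre_digraph \<Rightarrow> 'b pair_pre_digraph \<Rightarrow> bool" where
  "graph_homotopic A B \<longleftrightarrow>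
     (\<exists>G H :: nat pair_pre_digraph.
        digraph_iso (with_proj A) (with_proj G) \<and> homotopy_step\<^sup>*\<^sup>* G H \<and>
        digraph_iso (with_proj H) (with_proj B))"

definition unit_vector :: "'a \<Rightarrow> 'a \<Rightarrow> real" where
  "unit_vector k = (\<lambda>i. if i = k then 1 else 0)"

text \<open>
  The convex hull of the unit vectors of \<open>K\<close>, for finite \<open>K\<close>. It is written out because
  \<open>'a \<Rightarrow> real\<close> is not an instance of \<open>real_vector\<close>.
\<close>

definition spanned_simplex :: "'a set \<Rightarrow> ('a \<Rightarrow> real) set" where
  "spanned_simplex K =
     {(\<lambda>i. \<Sum>k\<in>K. t k * unit_vector k i) | t. (\<forall>k\<in>K. 0 \<le> t k) \<and> (\<Sum>k\<in>K. t k) = 1}"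

text \<open>
  \<open>\<real>\<^sup>n\<close>, with coordinates indexed by the \<open>n\<close> vertices of \<open>A\<close>, is identified with the functions
  vanishing outside \<open>pverts A\<close>, in the product topology, as in \<open>Euclidean_space\<close>. Such functions
  include all points of the simplices below.
\<close>

definition whitney_realization :: "'a pair_pre_digraph \<Rightarrow> ('a \<Rightarrow> real) topology" where
  "whitney_realization A =
     subtopology (powertop_real UNIV)
       (\<Union>{spanned_simplex K | K. K \<subseteq> pverts A \<and> complete_digraph (card K) (with_proj (induced A K))})"

end

theory Submission
  imports Defs
begin

text \<open>
  Let \<open>v\<close> be a vertex of \<open>G\<close> with contractible unit sphere. The realization of \<open>G\<close> is the union of
  the realization \<open>Y\<close> of \<open>G - v\<close> and of the closed star \<open>K\<close> of \<open>v\<close>, which is a cone; the two meet in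
  the realization \<open>C\<close> of the unit sphere. The point is that \<open>K\<close> can be pushed into \<open>C\<close> while \<open>C\<close> stays
  fixed, so that \<open>Y\<close> is a strong deformation retract of the whole. Knowing that \<open>C\<close> is contractible as
  a space is awkward for this purpose; the right notion is that of an absolute extensor: a set \<open>C\<close> such
  that every continuous map into \<open>C\<close> from a relatively closed set extends to a continuous map into \<open>C\<close>
  from the whole domain.

  If \<open>C\<close> and \<open>K\<close> are absolute extensors, the collapse consists of two extension problems. Extending
  the identity of \<open>C\<close> over \<open>K\<close> gives a retraction \<open>r\<close> of \<open>K\<close> onto \<open>C\<close>. Extending over \<open>[0,1] \<times> K\<close> the
  map that is \<open>r\<close> at time \<open>0\<close>, the identity at time \<open>1\<close> and constant in time on \<open>C\<close> gives the homotopy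
  (\<open>homotopy_equivalent_Un_absolute_extensor\<close>).

  That the realization of a contractible graph is an absolute extensor follows by induction along the
  definition of contractibility (\<open>absolute_extensor_contractible_graph\<close>): a point is one; the
  cone over one is one (\<open>absolute_extensor_cone\<close>); and the union of two closed ones
  whose intersection is one is again one (\<open>absolute_extensor_Un\<close>). The last two facts apply
  to the same decomposition of a graph into \<open>G - v\<close> and the star of \<open>v\<close>.

  Adding a vertex is the inverse of removing one, and isomorphic graphs have homeomorphic
  realizations, which lets the steps take place on graphs with vertices in \<open>nat\<close>. There the product
  topology on \<open>nat \<Rightarrow> real\<close> is the topology of a metric space, as the extension arguments require.
\<close>

section \<open>Points of the realization\<close>

text \<open>
  The arcs and the vertices are separate arguments because all the subgraphs that occur are induced:
  they share the arcs \<open>E\<close> and differ in \<open>V\<close> only.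
\<close>

definition clique_polyhedron :: "('a \<times> 'a) set \<Rightarrow> 'a set \<Rightarrow> ('a \<Rightarrow> real) set" where
  "clique_polyhedron E V =
     {x. \<exists>K. finite K \<and> K \<subseteq> V \<and> (\<forall>u\<in>K. \<forall>w\<in>K. (u, w) \<in> E \<longleftrightarrow> u \<noteq> w) \<and> x \<in> spanned_simplex K}"

lemma mem_clique_polyhedronI:
  assumes "finite K" "K \<subseteq> V" "\<And>u w. u \<in> K \<Longrightarrow> w \<in> K \<Longrightarrow> (u, w) \<in> E \<longleftrightarrow> u \<noteq> w"
    and "x \<in> spanned_simplex K"
  shows "x \<in> clique_polyhedron E V"
  using assms unfolding clique_polyhedron_def by blast

lemma mem_clique_polyhedronE:
  assumes "x \<in> clique_polyhedron E V"
  obtains K where "finite K" "K \<subseteq> V" "\<forall>u\<in>K. \<forall>w\<in>K. (u, w) \<in> E \<longleftrightarrow> u \<noteq> w"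
    "x \<in> spanned_simplex K"
  using assms unfolding clique_polyhedron_def by blast

lemma spanned_simplex_eq:
  assumes "finite K"
  shows "spanned_simplex K = {x. (\<forall>i. 0 \<le> x i) \<and> (\<forall>i. i \<notin> K \<longrightarrow> x i = 0) \<and> (\<Sum>i\<in>K. x i) = 1}"
proof -
  have eq: "(\<lambda>i. \<Sum>k\<in>K. t k * unit_vector k i) = (\<lambda>i. if i \<in> K then t i else 0)" for t :: "'a \<Rightarrow> real"
  proof
    fix i
    have "(\<Sum>k\<in>K. t k * unit_vector k i) = (\<Sum>k\<in>K. if i = k then t k else 0)"
      by (rule sum.cong) (auto simp: unit_vector_def)
    then show "(\<Sum>k\<in>K. t k * unit_vector k i) = (if i \<in> K then t i else 0)"
      using assms by simp
  qed
  show ?thesis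
  proof (intro equalityI subsetI)
    fix x assume "x \<in> spanned_simplex K"
    then show "x \<in> {x. (\<forall>i. 0 \<le> x i) \<and> (\<forall>i. i \<notin> K \<longrightarrow> x i = 0) \<and> (\<Sum>i\<in>K. x i) = 1}"
      unfolding spanned_simplex_def eq by auto
  next
    fix x :: "'a \<Rightarrow> real"
    assume x: "x \<in> {x. (\<forall>i. 0 \<le> x i) \<and> (\<forall>i. i \<notin> K \<longrightarrow> x i = 0) \<and> (\<Sum>i\<in>K. x i) = 1}"
    then have "x = (\<lambda>i. if i \<in> K then x i else 0)" by auto
    with x show "x \<in> spanned_simplex K"
      unfolding spanned_simplex_def eq by blast
  qed
qed

lemma clique_polyhedron_coordinates:
  assumes "x \<in> clique_polyhedron E V"
  shows "0 \<le> x i" "x i \<le> 1" "i \<notin> V \<Longrightarrow> x i = 0"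
proof -
  obtain K where K: "finite K" "K \<subseteq> V" "x \<in> spanned_simplex K"
    using assms by (rule mem_clique_polyhedronE)
  then have x: "\<And>i. 0 \<le> x i" "\<And>i. i \<notin> K \<Longrightarrow> x i = 0" "(\<Sum>i\<in>K. x i) = 1"
    by (auto simp: spanned_simplex_eq)
  show "0 \<le> x i" by (rule x)
  show "x i \<le> 1"
    using member_le_sum[of i K x] x K(1) by (cases "i \<in> K") auto
  show "i \<notin> V \<Longrightarrow> x i = 0" using x(2) K(2) by auto
qed

lemma clique_polyhedron_induced:
  "clique_polyhedron (parcs (induced G W)) (pverts (induced G W)) = clique_polyhedron (parcs G) W"
  unfolding clique_polyhedron_def induced_def by (auto simp: subset_iff)

lemma whitney_realization_eq:
  "whitney_realization A = subtopology (powertop_real UNIV) (clique_polyhedron (parcs A) (pverts A))"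
proof -
  have "K \<subseteq> pverts A \<and> complete_digraph (card K) (with_proj (induced A K)) \<longleftrightarrow>
        finite K \<and> K \<subseteq> pverts A \<and> (\<forall>u\<in>K. \<forall>w\<in>K. (u, w) \<in> parcs A \<longleftrightarrow> u \<noteq> w)" for K
    unfolding complete_digraph_pair_def by (auto simp: induced_def)
  then show ?thesis
    unfolding whitney_realization_def clique_polyhedron_def
    by (intro arg_cong[where f = "subtopology (powertop_real UNIV)"]) auto
qed

lemma whitney_realization_eq_top_of_set:
  fixes A :: "nat pair_pre_digraph"
  shows "whitney_realization A = top_of_set (clique_polyhedron (parcs A) (pverts A))"
  by (simp add: whitney_realization_eq euclidean_product_topology)

lemma closed_clique_polyhedron:
  assumes "finite V"
  shows "closed (clique_polyhedron E V)"
proof -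
  have "closed (spanned_simplex K)" if "finite K" for K :: "'a set"
    unfolding spanned_simplex_eq[OF that]
    by (intro closed_Collect_conj closed_Collect_all closed_Collect_imp closed_Collect_le
        closed_Collect_eq continuous_intros open_Collect_const continuous_on_product_coordinates)
  moreover have "clique_polyhedron E V =
      (\<Union>K\<in>{K. finite K \<and> K \<subseteq> V \<and> (\<forall>u\<in>K. \<forall>w\<in>K. (u, w) \<in> E \<longleftrightarrow> u \<noteq> w)}. spanned_simplex K)"
    unfolding clique_polyhedron_def by blast
  moreover have "finite {K. finite K \<and> K \<subseteq> V \<and> (\<forall>u\<in>K. \<forall>w\<in>K. (u, w) \<in> E \<longleftrightarrow> u \<noteq> w)}"
    by (rule finite_subset[of _ "Pow V"]) (use assms in auto)
  ultimately show ?thesis by (simp add: closed_UN)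
qed

text \<open>
  The coordinates that are positive at a point of a simplex lie in every simplex through that point.
  Hence if the point lies in the polyhedron over \<open>Q\<close>, its clique may be cut down to \<open>Q\<close>.
\<close>

lemma clique_polyhedron_Int:
  "clique_polyhedron E P \<inter> clique_polyhedron E Q = clique_polyhedron E (P \<inter> Q)"
proof (intro equalityI subsetI)
  fix x assume x: "x \<in> clique_polyhedron E P \<inter> clique_polyhedron E Q"
  obtain K where K: "finite K" "K \<subseteq> P" "\<forall>u\<in>K. \<forall>w\<in>K. (u, w) \<in> E \<longleftrightarrow> u \<noteq> w"
    "x \<in> spanned_simplex K" using IntD1[OF x] by (rule mem_clique_polyhedronE)
  have "sum x (K \<inter> Q) = sum x K"
    using K(1) clique_polyhedron_coordinates(3)[of x E Q] x by (intro sum.mono_neutral_left) auto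
  then have "x \<in> spanned_simplex (K \<inter> Q)"
    using K(1,4) x clique_polyhedron_coordinates(3)[of x E Q] by (auto simp: spanned_simplex_eq)
  then show "x \<in> clique_polyhedron E (P \<inter> Q)"
    using K by (intro mem_clique_polyhedronI[of "K \<inter> Q"]) auto
qed (auto simp: clique_polyhedron_def)

text \<open>A clique that contains \<open>v\<close> consists of \<open>v\<close> and neighbours of \<open>v\<close>.\<close>

lemma clique_polyhedron_split_vertex:
  assumes "v \<in> V"
  shows "clique_polyhedron E V =
    clique_polyhedron E (V - {v}) \<union> clique_polyhedron E (insert v {w \<in> V. (v, w) \<in> E})"
proof (intro equalityI subsetI)
  fix x assume "x \<in> clique_polyhedron E V"
  then obtain K where K: "finite K" "K \<subseteq> V" "\<forall>u\<in>K. \<forall>w\<in>K. (u, w) \<in> E \<longleftrightarrow> u \<noteq> w"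
    "x \<in> spanned_simplex K" by (rule mem_clique_polyhedronE)
  then have "K \<subseteq> V - {v} \<or> K \<subseteq> insert v {w \<in> V. (v, w) \<in> E}" by auto
  then show "x \<in> clique_polyhedron E (V - {v}) \<union>
      clique_polyhedron E (insert v {w \<in> V. (v, w) \<in> E})"
    using K unfolding clique_polyhedron_def by blast
next
  fix x assume "x \<in> clique_polyhedron E (V - {v}) \<union>
      clique_polyhedron E (insert v {w \<in> V. (v, w) \<in> E})"
  then show "x \<in> clique_polyhedron E V"
    using assms unfolding clique_polyhedron_def by blast
qed

section \<open>Cones\<close>

text \<open>
  The geometric cone with apex the unit vector of \<open>v\<close>, for a base \<open>S\<close> in the hyperplane where the
  coordinate \<open>v\<close> vanishes. That coordinate is then the cone parameter \<open>t\<close>.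
\<close>

definition cone_over :: "'a \<Rightarrow> ('a \<Rightarrow> real) set \<Rightarrow> ('a \<Rightarrow> real) set" where
  "cone_over v S = {(\<lambda>i. (1 - t) * s i)(v := t) | t s. 0 \<le> t \<and> t \<le> 1 \<and> s \<in> S}"

text \<open>
  Since \<open>v\<close> is adjacent to all of \<open>W\<close>, the cliques of \<open>W\<close> stay cliques when \<open>v\<close> is added. Conversely a
  point other than the apex is projected from the apex to the base by dropping its coordinate \<open>v\<close>
  and rescaling. The base must be nonempty, because the cone over the empty set has no apex.
\<close>

lemma clique_polyhedron_cone:
  assumes v: "v \<notin> W" "(v, v) \<notin> E"
    and adj: "\<And>w. w \<in> W \<Longrightarrow> (v, w) \<in> E \<and> (w, v) \<in> E"
    and ne: "clique_polyhedron E W \<noteq> {}"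
  shows "clique_polyhedron E (insert v W) = cone_over v (clique_polyhedron E W)"
proof (intro equalityI subsetI)
  fix x assume x: "x \<in> clique_polyhedron E (insert v W)"
  then obtain K where K: "finite K" "K \<subseteq> insert v W"
    "\<forall>u\<in>K. \<forall>w\<in>K. (u, w) \<in> E \<longleftrightarrow> u \<noteq> w" "x \<in> spanned_simplex K"
    by (rule mem_clique_polyhedronE)
  have xK: "\<And>i. 0 \<le> x i" "\<And>i. i \<notin> K \<Longrightarrow> x i = 0" "(\<Sum>i\<in>K. x i) = 1"
    using K by (auto simp: spanned_simplex_eq)
  have xv: "0 \<le> x v" "x v \<le> 1" using clique_polyhedron_coordinates[OF x] by auto
  have rest: "(\<Sum>i\<in>K - {v}. x i) = 1 - x v"
    using xK K(1) sum.remove[of K v x] by (cases "v \<in> K") auto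
  show "x \<in> cone_over v (clique_polyhedron E W)"
  proof (cases "x v = 1")
    case True
    have "x i = 0" if "i \<noteq> v" for i
      using rest True xK(1,2) K(1) sum_nonneg_eq_0_iff[of "K - {v}" x] that by auto
    then have "x = (\<lambda>i. (1 - 1) * s i)(v := 1)" for s :: "'a \<Rightarrow> real"
      using True by auto
    with ne show ?thesis unfolding cone_over_def by fastforce
  next
    case False
    then have pos: "0 < 1 - x v" using xv by auto
    define s where "s = (\<lambda>i. if i = v then 0 else x i / (1 - x v))"
    have "(\<Sum>i\<in>K - {v}. s i) = (\<Sum>i\<in>K - {v}. x i / (1 - x v))"
      by (rule sum.cong) (auto simp: s_def)
    also have "\<dots> = 1" using rest pos by (simp flip: sum_divide_distrib)
    finally have "s \<in> spanned_simplex (K - {v})"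
      using K(1) xK pos by (auto simp: spanned_simplex_eq s_def)
    then have "s \<in> clique_polyhedron E W"
      using K by (intro mem_clique_polyhedronI[of "K - {v}"]) auto
    moreover have "x = (\<lambda>i. (1 - x v) * s i)(v := x v)"
      using pos by (auto simp: s_def)
    ultimately show ?thesis using xv unfolding cone_over_def by blast
  qed
next
  fix x assume "x \<in> cone_over v (clique_polyhedron E W)"
  then obtain t s where t: "0 \<le> t" "t \<le> 1" and s: "s \<in> clique_polyhedron E W"
    and x: "x = (\<lambda>i. (1 - t) * s i)(v := t)" unfolding cone_over_def by blast
  obtain K where K: "finite K" "K \<subseteq> W"
    "\<forall>u\<in>K. \<forall>w\<in>K. (u, w) \<in> E \<longleftrightarrow> u \<noteq> w" "s \<in> spanned_simplex K"
    using s by (rule mem_clique_polyhedronE)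
  have vK: "v \<notin> K" using K(2) v by auto
  have "(\<Sum>i\<in>K. x i) = (\<Sum>i\<in>K. (1 - t) * s i)"
    using vK by (intro sum.cong) (auto simp: x)
  also have "\<dots> = 1 - t" using K by (simp add: spanned_simplex_eq flip: sum_distrib_left)
  finally have "x \<in> spanned_simplex (insert v K)"
    using K(1,4) vK t by (auto simp: spanned_simplex_eq) (auto simp: x)
  then show "x \<in> clique_polyhedron E (insert v W)"
    using K adj v vK by (intro mem_clique_polyhedronI[of "insert v K"]) auto
qed

section \<open>Absolute extensors\<close>

text \<open>
  The domains lie in \<open>real \<times> (nat \<Rightarrow> real)\<close> so that homotopies of subsets of \<open>nat \<Rightarrow> real\<close> are among the
  maps that can be extended. The set \<open>U\<close> is arbitrary, not only closed: the extension into a cone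
  takes place over a relatively open set, away from the apex.
\<close>

definition absolute_extensor :: "(nat \<Rightarrow> real) set \<Rightarrow> bool" where
  "absolute_extensor Y \<longleftrightarrow>
     (\<forall>U T. \<forall>f :: real \<times> (nat \<Rightarrow> real) \<Rightarrow> nat \<Rightarrow> real.
        closedin (top_of_set U) T \<and> continuous_on T f \<and> f ` T \<subseteq> Y \<longrightarrow>
        (\<exists>g. continuous_on U g \<and> g ` U \<subseteq> Y \<and> (\<forall>z\<in>T. g z = f z)))"

lemma absolute_extensorE:
  fixes f :: "real \<times> (nat \<Rightarrow> real) \<Rightarrow> nat \<Rightarrow> real"
  assumes "absolute_extensor Y" "closedin (top_of_set U) T" "continuous_on T f" "f ` T \<subseteq> Y"
  obtains g where "continuous_on U g" "g ` U \<subseteq> Y" "\<And>z. z \<in> T \<Longrightarrow> g z = f z"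
  using assms unfolding absolute_extensor_def by metis

text \<open>The empty map extends to a map on the whole space, which has values.\<close>

lemma absolute_extensor_nonempty:
  assumes "absolute_extensor Y"
  shows "Y \<noteq> {}"
proof -
  have "\<exists>g :: real \<times> (nat \<Rightarrow> real) \<Rightarrow> nat \<Rightarrow> real. g ` UNIV \<subseteq> Y"
    using assms unfolding absolute_extensor_def
    by (metis closedin_empty continuous_on_empty empty_subsetI image_empty)
  then show ?thesis by auto
qed

lemma absolute_extensor_singleton: "absolute_extensor {a}"
  unfolding absolute_extensor_def by (auto intro!: exI[of _ "\<lambda>_. a"])

text \<open>
  Prescribing values on two closed sets amounts to prescribing them on the union. In this
  form the extension property serves both to glue extensions and to build homotopies.
\<close>

lemma absolute_extensor_extend_two:
  fixes f h :: "real \<times> (nat \<Rightarrow> real) \<Rightarrow> nat \<Rightarrow> real"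
  assumes Y: "absolute_extensor Y"
    and S: "closedin (top_of_set U) S" "continuous_on S f" "f ` S \<subseteq> Y"
    and T: "closedin (top_of_set U) T" "continuous_on T h" "h ` T \<subseteq> Y"
    and agree: "\<And>z. z \<in> S \<Longrightarrow> z \<in> T \<Longrightarrow> f z = h z"
  obtains g where "continuous_on U g" "g ` U \<subseteq> Y" "\<And>z. z \<in> S \<Longrightarrow> g z = f z"
    "\<And>z. z \<in> T \<Longrightarrow> g z = h z"
proof -
  let ?p = "\<lambda>z. if z \<in> S then f z else h z"
  have sub: "S \<subseteq> U" "T \<subseteq> U" using S(1) T(1) by (auto dest: closedin_imp_subset)
  have "continuous_on (S \<union> T) ?p"
    using S T agree sub
    by (intro continuous_on_cases_local) (auto intro: closedin_subset_trans[where U = U])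
  moreover have "?p ` (S \<union> T) \<subseteq> Y" using S T by auto
  ultimately obtain g where "continuous_on U g" "g ` U \<subseteq> Y" "\<And>z. z \<in> S \<union> T \<Longrightarrow> g z = ?p z"
    by (rule absolute_extensorE[OF Y closedin_Un[OF S(1) T(1)]]) (rule that)
  with agree show thesis by (intro that[of g]) auto
qed

text \<open>
  The domain \<open>U\<close> is cut into the parts \<open>UA\<close> and \<open>UB\<close> that are nearer to the preimage of \<open>A\<close> and of \<open>B\<close>
  respectively. On the interface \<open>N\<close> the map is first extended into \<open>A \<inter> B\<close>; from there it extends over
  \<open>UA\<close> into \<open>A\<close> and over \<open>UB\<close> into \<open>B\<close>, and the two extensions agree on \<open>N\<close>.
\<close>

lemma absolute_extensor_Un:
  assumes cl: "closed A" "closed B"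
    and A: "absolute_extensor A" and B: "absolute_extensor B" and AB: "absolute_extensor (A \<inter> B)"
  shows "absolute_extensor (A \<union> B)"
  unfolding absolute_extensor_def
proof (intro allI impI)
  fix U T :: "(real \<times> (nat \<Rightarrow> real)) set" and f :: "real \<times> (nat \<Rightarrow> real) \<Rightarrow> nat \<Rightarrow> real"
  assume "closedin (top_of_set U) T \<and> continuous_on T f \<and> f ` T \<subseteq> A \<union> B"
  then have T: "closedin (top_of_set U) T" and f: "continuous_on T f" and fAB: "f ` T \<subseteq> A \<union> B"
    by auto
  define TA where "TA = T \<inter> f -` A"
  define TB where "TB = T \<inter> f -` B"
  have TA: "closedin (top_of_set U) TA" and TB: "closedin (top_of_set U) TB"
    unfolding TA_def TB_def
    by (rule closedin_trans[OF continuous_closedin_preimage[OF f cl(1)] T],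
        rule closedin_trans[OF continuous_closedin_preimage[OF f cl(2)] T])
  have TAB: "T = TA \<union> TB" using fAB by (auto simp: TA_def TB_def)
  show "\<exists>g. continuous_on U g \<and> g ` U \<subseteq> A \<union> B \<and> (\<forall>z\<in>T. g z = f z)"
  proof (cases "TA = {} \<or> TB = {}")
    case True
    \<comment> \<open>Here the distances do not separate, since \<open>infdist\<close> to the empty set is \<open>0\<close>.\<close>
    then have "f ` T \<subseteq> A \<or> f ` T \<subseteq> B" using fAB unfolding TA_def TB_def by blast
    then show ?thesis
    proof
      assume "f ` T \<subseteq> A"
      then obtain g where "continuous_on U g" "g ` U \<subseteq> A" "\<And>z. z \<in> T \<Longrightarrow> g z = f z"
        using absolute_extensorE[OF A T f] by blast
      then show ?thesis by blast
    next
      assume "f ` T \<subseteq> B"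
      then obtain g where "continuous_on U g" "g ` U \<subseteq> B" "\<And>z. z \<in> T \<Longrightarrow> g z = f z"
        using absolute_extensorE[OF B T f] by blast
      then show ?thesis by blast
    qed
  next
    case False
    define UA where "UA = {z \<in> U. infdist z TA \<le> infdist z TB}"
    define UB where "UB = {z \<in> U. infdist z TB \<le> infdist z TA}"
    have UA: "closedin (top_of_set U) UA" and UB: "closedin (top_of_set U) UB"
    proof -
      have cl: "closed {z. infdist z TA \<le> infdist z TB}" "closed {z. infdist z TB \<le> infdist z TA}"
        by (intro closed_Collect_le continuous_intros)+
      have "UA = U \<inter> {z. infdist z TA \<le> infdist z TB}" "UB = U \<inter> {z. infdist z TB \<le> infdist z TA}"
        by (auto simp: UA_def UB_def)
      then show "closedin (top_of_set U) UA" "closedin (top_of_set U) UB"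
        using cl by (auto intro: closedin_closed_Int)
    qed
    have in0: "z \<in> S" if "closedin (top_of_set U) S" "S \<noteq> {}" "z \<in> U" "infdist z S \<le> 0" for z S
    proof -
      have "z \<in> closure S" using that infdist_nonneg[of z S] by (simp add: in_closure_iff_infdist_zero)
      then show ?thesis using that(1,3) by (metis IntI closedin_closed closure_minimal in_mono inf_le2)
    qed
    have TU: "TA \<subseteq> UA" "TB \<subseteq> UB"
      using closedin_imp_subset[OF TA] closedin_imp_subset[OF TB]
      by (auto simp: UA_def UB_def infdist_nonneg)
    define N where "N = UA \<inter> UB"
    \<comment> \<open>A point of \<open>TA\<close> on the interface has distance \<open>0\<close> from \<open>TB\<close>, which is closed.\<close>
    have TAN: "z \<in> TB" if "z \<in> TA" "z \<in> N" for z
    proof (rule in0[OF TB])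
      have "infdist z TB \<le> infdist z TA" using that(2) by (simp add: N_def UB_def)
      then show "infdist z TB \<le> 0" using that(1) by simp
    qed (use that False in \<open>auto simp: N_def UA_def\<close>)
    have TBN: "z \<in> TA" if "z \<in> TB" "z \<in> N" for z
    proof (rule in0[OF TA])
      have "infdist z TA \<le> infdist z TB" using that(2) by (simp add: N_def UA_def)
      then show "infdist z TA \<le> 0" using that(1) by simp
    qed (use that False in \<open>auto simp: N_def UA_def\<close>)
    have N: "closedin (top_of_set U) N" unfolding N_def using UA UB by (rule closedin_Int)
    have sub: "UA \<subseteq> U" "UB \<subseteq> U" "N \<subseteq> U" "N \<subseteq> UA" "N \<subseteq> UB" by (auto simp: UA_def UB_def N_def)
    have "closedin (top_of_set N) (T \<inter> N)"
      using closedin_Int[OF T N] sub by (auto intro: closedin_subset_trans)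
    moreover have "f ` (T \<inter> N) \<subseteq> A \<inter> B"
    proof -
      have "T \<inter> N \<subseteq> TA \<inter> TB" using TAN TBN TAB by blast
      then show ?thesis by (auto simp: TA_def TB_def)
    qed
    ultimately obtain h where h: "continuous_on N h" "h ` N \<subseteq> A \<inter> B"
      and hf: "\<And>z. z \<in> T \<inter> N \<Longrightarrow> h z = f z"
      by (rule absolute_extensorE[OF AB _ continuous_on_subset[OF f Int_lower1]]) (rule that)
    have cTA: "closedin (top_of_set UA) TA" "closedin (top_of_set UA) N"
      and cTB: "closedin (top_of_set UB) TB" "closedin (top_of_set UB) N"
      using TA TB N sub TU by (auto intro: closedin_subset_trans)
    have T_sub: "TA \<subseteq> T" "TB \<subseteq> T" and f_img: "f ` TA \<subseteq> A" "f ` TB \<subseteq> B"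
      by (auto simp: TA_def TB_def)
    have f_sub: "continuous_on TA f" "continuous_on TB f"
      using f T_sub by (auto intro: continuous_on_subset)
    have h_img: "h ` N \<subseteq> A" "h ` N \<subseteq> B" using h(2) by auto
    obtain gA where gA: "continuous_on UA gA" "gA ` UA \<subseteq> A"
      "\<And>z. z \<in> TA \<Longrightarrow> gA z = f z" "\<And>z. z \<in> N \<Longrightarrow> gA z = h z"
      by (rule absolute_extensor_extend_two[OF A cTA(1) f_sub(1) f_img(1) cTA(2) h(1) h_img(1)])
        (use hf T_sub in auto)
    obtain gB where gB: "continuous_on UB gB" "gB ` UB \<subseteq> B"
      "\<And>z. z \<in> TB \<Longrightarrow> gB z = f z" "\<And>z. z \<in> N \<Longrightarrow> gB z = h z"
      by (rule absolute_extensor_extend_two[OF B cTB(1) f_sub(2) f_img(2) cTB(2) h(1) h_img(2)])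
        (use hf T_sub in auto)
    have U: "UA \<union> UB = U" by (auto simp: UA_def UB_def)
    let ?g = "\<lambda>z. if z \<in> UA then gA z else gB z"
    have "continuous_on (UA \<union> UB) ?g"
      using gA gB UA UB U by (intro continuous_on_cases_local) (auto simp: N_def)
    moreover have "?g ` U \<subseteq> A \<union> B" using gA(2) gB(2) U by auto
    moreover have "?g z = f z" if "z \<in> T" for z
    proof (cases "z \<in> TA")
      case True
      then show ?thesis using gA TU by auto
    next
      case False
      then have "z \<in> TB" "z \<in> UB" using that TAB TU by auto
      then show ?thesis using gB(3) gA(4) hf[of z] that by (auto simp: N_def)
    qed
    ultimately show ?thesis unfolding U by blast
  qed
qed

text \<open>
  The cone parameter of the map is a function into \<open>[0,1]\<close> and extends by Tietze's theorem. The
  base point is defined only where the parameter is less than \<open>1\<close>, so it is extended only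
  over the part \<open>U'\<close> of the domain where the extended parameter is less than \<open>1\<close>. As the base is
  bounded, the resulting point of the cone tends to the apex when the parameter tends to \<open>1\<close>,
  no matter how the base point behaves there.
\<close>

lemma absolute_extensor_cone:
  assumes S: "absolute_extensor S"
    and bounds: "\<And>s i. s \<in> S \<Longrightarrow> 0 \<le> s i \<and> s i \<le> 1" and sv: "\<And>s. s \<in> S \<Longrightarrow> s v = 0"
  shows "absolute_extensor (cone_over v S)"
  unfolding absolute_extensor_def
proof (intro allI impI)
  fix U T :: "(real \<times> (nat \<Rightarrow> real)) set" and f :: "real \<times> (nat \<Rightarrow> real) \<Rightarrow> nat \<Rightarrow> real"
  assume "closedin (top_of_set U) T \<and> continuous_on T f \<and> f ` T \<subseteq> cone_over v S"
  then have T: "closedin (top_of_set U) T" and f: "continuous_on T f" and fC: "f ` T \<subseteq> cone_over v S"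
    by auto
  have fi: "continuous_on T (\<lambda>z. f z i)" for i
    using f by (rule continuous_on_product_then_coordinatewise)
  have fv: "0 \<le> f z v \<and> f z v \<le> 1" if "z \<in> T" for z
    using fC that by (force simp: cone_over_def)
  obtain \<tau> where \<tau>: "continuous_on U \<tau>" "\<And>z. z \<in> T \<Longrightarrow> \<tau> z = f z v"
    "\<And>z. z \<in> U \<Longrightarrow> \<tau> z \<in> cbox 0 (1::real)"
    by (rule Tietze_closed_interval_1[OF fi[of v] T, of 0 1]) (use fv in auto)
  have \<tau>01: "0 \<le> \<tau> z" "\<tau> z \<le> 1" if "z \<in> U" for z using \<tau>(3)[OF that] by auto
  define U' where "U' = U \<inter> \<tau> -` {..<1}"
  have U': "openin (top_of_set U) U'"
    unfolding U'_def using \<tau>(1) by (intro continuous_openin_preimage_gen) auto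
  have U'U: "U' \<subseteq> U" by (auto simp: U'_def)
  \<comment> \<open>The base point of \<open>f z\<close>, that is, its projection from the apex.\<close>
  define p where "p z i = (if i = v then 0 else f z i / (1 - f z v))" for z i
  have TU': "f z v < 1" if "z \<in> T \<inter> U'" for z
    using that \<tau>(2)[of z] by (auto simp: U'_def)
  have p_cont: "continuous_on (T \<inter> U') p"
  proof (rule continuous_on_coordinatewise_then_product)
    fix i
    have "continuous_on (T \<inter> U') (\<lambda>z. f z i / (1 - f z v))"
      using TU' by (intro continuous_intros continuous_on_subset[OF fi]) force+
    then show "continuous_on (T \<inter> U') (\<lambda>z. p z i)" by (cases "i = v") (auto simp: p_def)
  qed
  have p_S: "p z \<in> S \<and> f z = (\<lambda>i. (1 - f z v) * p z i)(v := f z v)" if "z \<in> T \<inter> U'" for z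
  proof -
    have "f z \<in> cone_over v S" using fC that by auto
    then obtain t s where ts: "s \<in> S" "f z = (\<lambda>i. (1 - t) * s i)(v := t)"
      unfolding cone_over_def by blast
    then have "p z = s" using TU'[OF that] sv[OF ts(1)] by (auto simp: p_def)
    with ts show ?thesis by auto
  qed
  have "closedin (top_of_set U') (T \<inter> U')"
    using T U'U by (metis closedin_subtopology_Int_closed inf.absorb_iff2 inf_commute subtopology_subtopology)
  moreover have "p ` (T \<inter> U') \<subseteq> S" using p_S by blast
  ultimately obtain \<sigma> where \<sigma>: "continuous_on U' \<sigma>" "\<sigma> ` U' \<subseteq> S" "\<And>z. z \<in> T \<inter> U' \<Longrightarrow> \<sigma> z = p z"
    by (rule absolute_extensorE[OF S _ p_cont]) (rule that)
  obtain s0 where s0: "s0 \<in> S" using absolute_extensor_nonempty[OF S] by blast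
  \<comment> \<open>The value \<open>s0\<close> only serves to have a base point over the apex as well.\<close>
  define q where "q z = (if z \<in> U' then \<sigma> z else s0)" for z
  have qS: "q z \<in> S" for z using \<sigma>(2) s0 by (auto simp: q_def)
  define g where "g z = (\<lambda>i. (1 - \<tau> z) * q z i)(v := \<tau> z)" for z
  have "continuous_on U (\<lambda>z. (1 - \<tau> z) * q z i)" for i
    unfolding continuous_on_def
  proof
    fix z assume z: "z \<in> U"
    show "((\<lambda>z. (1 - \<tau> z) * q z i) \<longlongrightarrow> (1 - \<tau> z) * q z i) (at z within U)"
    proof (cases "z \<in> U'")
      case True
      have "continuous_on U' (\<lambda>z. (1 - \<tau> z) * \<sigma> z i)"
        using continuous_on_product_then_coordinatewise[OF \<sigma>(1)] continuous_on_subset[OF \<tau>(1) U'U]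
        by (intro continuous_intros) auto
      then have "continuous_on U' (\<lambda>z. (1 - \<tau> z) * q z i)"
        by (rule continuous_on_eq) (auto simp: q_def)
      then have "((\<lambda>z. (1 - \<tau> z) * q z i) \<longlongrightarrow> (1 - \<tau> z) * q z i) (at z within U')"
        using True by (simp add: continuous_on_def)
      moreover have "at z within U = at z within U'"
      proof -
        obtain O' where "open O'" "U' = U \<inter> O'" using U' by (auto simp: openin_open)
        then show ?thesis using True by (intro at_within_nhd[of z O']) auto
      qed
      ultimately show ?thesis by simp
    next
      case False
      then have "\<tau> z = 1" using z \<tau>01[OF z] by (auto simp: U'_def)
      have lim: "((\<lambda>y. 1 - \<tau> y) \<longlongrightarrow> 1 - \<tau> z) (at z within U)"
        using \<tau>(1) z by (intro tendsto_intros) (auto simp: continuous_on_def)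
      have "((\<lambda>z. (1 - \<tau> z) * q z i) \<longlongrightarrow> 0) (at z within U)"
      proof (rule tendsto_sandwich[OF _ _ tendsto_const])
        show "((\<lambda>y. 1 - \<tau> y) \<longlongrightarrow> 0) (at z within U)" using lim \<open>\<tau> z = 1\<close> by simp
        show "\<forall>\<^sub>F y in at z within U. 0 \<le> (1 - \<tau> y) * q y i"
          using bounds[OF qS] \<tau>01 by (auto simp: eventually_at_filter)
        show "\<forall>\<^sub>F y in at z within U. (1 - \<tau> y) * q y i \<le> 1 - \<tau> y"
          using bounds[OF qS] \<tau>01 by (auto simp: eventually_at_filter intro!: always_eventually mult_left_le)
      qed
      then show ?thesis using \<open>\<tau> z = 1\<close> by simp
    qed
  qed
  then have "continuous_on U (\<lambda>z. g z i)" for i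
    using \<tau>(1) by (cases "i = v") (auto simp: g_def)
  then have "continuous_on U g" by (rule continuous_on_coordinatewise_then_product)
  moreover have "g ` U \<subseteq> cone_over v S"
    using qS \<tau>01 unfolding g_def cone_over_def by blast
  moreover have "g z = f z" if z: "z \<in> T" for z
  proof (cases "z \<in> U'")
    case True
    then show ?thesis using p_S[of z] z \<sigma>(3)[of z] \<tau>(2)[OF z] by (auto simp: g_def q_def)
  next
    case False
    then have "f z v = 1"
      using z \<tau>(2)[OF z] \<tau>01[of z] closedin_imp_subset[OF T] by (force simp: U'_def)
    moreover have "f z \<in> cone_over v S" using fC z by auto
    then obtain t s where "f z = (\<lambda>i. (1 - t) * s i)(v := t)"
      unfolding cone_over_def by blast
    ultimately show ?thesis using \<tau>(2)[OF z] by (auto simp: g_def)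
  qed
  ultimately show "\<exists>g. continuous_on U g \<and> g ` U \<subseteq> cone_over v S \<and> (\<forall>z\<in>T. g z = f z)" by blast
qed

section \<open>Collapsing an absolute extensor\<close>

text \<open>
  Every map used on \<open>K\<close> below restricts to the identity on \<open>Y \<inter> K\<close>, at all times, and so
  continues by the identity of \<open>Y\<close>.
\<close>

lemma homotopy_equivalent_Un_absolute_extensor:
  assumes cl: "closed Y" "closed K"
    and K: "absolute_extensor K" and YK: "absolute_extensor (Y \<inter> K)"
  shows "top_of_set (Y \<union> K) homotopy_equivalent_space top_of_set Y"
proof -
  \<comment> \<open>The retraction of \<open>K\<close> onto \<open>Y \<inter> K\<close>, on a copy of \<open>K\<close> at time \<open>0\<close>.\<close>
  obtain r' where r': "continuous_on ({0} \<times> K) r'" "r' ` ({0} \<times> K) \<subseteq> Y \<inter> K"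
    "\<And>z. z \<in> {0::real} \<times> (Y \<inter> K) \<Longrightarrow> r' z = snd z"
  proof (rule absolute_extensorE[OF YK, where f = snd])
    show "closedin (top_of_set ({0} \<times> K)) ({0::real} \<times> (Y \<inter> K))"
      using cl by (intro closed_subset closed_Times closed_Int) auto
  qed (auto intro: continuous_intros that)
  define r where "r x = r' (0, x)" for x
  have r: "continuous_on K r" "\<And>x. x \<in> K \<Longrightarrow> r x \<in> Y \<inter> K" "\<And>x. x \<in> Y \<inter> K \<Longrightarrow> r x = x"
    unfolding r_def using r'
    by (auto intro!: continuous_on_compose2[OF r'(1)] continuous_on_Pair continuous_on_const continuous_on_id)
  let ?I = "{0..1::real}"
  \<comment> \<open>The prescribed values of the homotopy at its two ends.\<close>
  define e where "e z = (if fst z = 0 then r (snd z) else snd z)" for z :: "real \<times> (nat \<Rightarrow> real)"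
  have "continuous_on ({0} \<times> K \<union> {1} \<times> K) e"
  proof (rule continuous_on_closed_Un)
    show "continuous_on ({0} \<times> K) e"
      by (rule continuous_on_eq[of _ "\<lambda>z. r (snd z)"])
        (auto simp: e_def intro!: continuous_on_compose2[OF r(1)] continuous_on_snd continuous_on_id)
    show "continuous_on ({1} \<times> K) e"
      by (rule continuous_on_eq[of _ snd]) (auto simp: e_def intro: continuous_intros)
  qed (use cl in \<open>auto intro: closed_Times\<close>)
  then have e: "continuous_on ({0, 1} \<times> K) e"
    by (rule continuous_on_subset) auto
  have e_YK: "e z = snd z" if "z \<in> ?I \<times> (Y \<inter> K)" for z
    using that r(3) by (auto simp: e_def)
  have H_dom: "closedin (top_of_set (?I \<times> K)) (?I \<times> (Y \<inter> K))"
      "closedin (top_of_set (?I \<times> K)) ({0, 1} \<times> K)"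
    using cl by (intro closed_subset closed_Times closed_Int; auto)+
  have H_img: "snd ` (?I \<times> (Y \<inter> K)) \<subseteq> K" "e ` ({0, 1} \<times> K) \<subseteq> K"
    using r(2) by (auto simp: e_def)
  obtain H where H: "continuous_on (?I \<times> K) H" "H ` (?I \<times> K) \<subseteq> K"
    "\<And>z. z \<in> ?I \<times> (Y \<inter> K) \<Longrightarrow> H z = snd z" "\<And>z. z \<in> {0, 1} \<times> K \<Longrightarrow> H z = e z"
    by (rule absolute_extensor_extend_two[OF K H_dom(1) _ H_img(1) H_dom(2) e H_img(2)])
      (auto simp: e_YK intro: continuous_on_snd continuous_on_id)
  define \<rho> where "\<rho> x = (if x \<in> K then r x else x)" for x
  define h where "h z = (if snd z \<in> K then H z else snd z)" for z
  have \<rho>_cont: "continuous_on (K \<union> Y) \<rho>"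
    unfolding \<rho>_def using cl r
    by (intro continuous_on_cases_local) (auto intro: closed_subset continuous_intros)
  have "continuous_on (?I \<times> K \<union> ?I \<times> Y) (\<lambda>z. if snd z \<in> K then H z else snd z)"
    using cl H
    by (intro continuous_on_cases_local) (auto intro!: closed_subset closed_Times continuous_on_snd continuous_on_id)
  then have h_cont: "continuous_on (?I \<times> (Y \<union> K)) h"
    unfolding h_def by (rule continuous_on_subset) auto
  have h_in: "h ` (?I \<times> (Y \<union> K)) \<subseteq> Y \<union> K" using H(2) by (auto simp: h_def image_subset_iff)
  have "retraction_maps (top_of_set (Y \<union> K)) (top_of_set Y) \<rho> id"
    unfolding retraction_maps_def using \<rho>_cont r
    by (auto simp: \<rho>_def Un_commute continuous_map_in_subtopology)
  moreover have "homotopic_with (\<lambda>x. True) (top_of_set (Y \<union> K)) (top_of_set (Y \<union> K)) \<rho> id"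
    unfolding homotopic_with_def
  proof (intro exI[of _ h] conjI allI ballI)
    show "continuous_map (prod_topology (top_of_set ?I) (top_of_set (Y \<union> K))) (top_of_set (Y \<union> K)) h"
      using h_cont h_in by (auto simp: continuous_map_in_subtopology)
  qed (auto simp: h_def \<rho>_def e_def H(4))
  ultimately show ?thesis by (rule deformation_retract_imp_homotopy_equivalent_space[rotated])
qed

section \<open>Contractible graphs and homotopy steps\<close>

lemma pair_graphD:
  assumes "pair_graph G"
  shows "finite (pverts G)" "(u, w) \<in> parcs G \<Longrightarrow> u \<in> pverts G" "(u, w) \<in> parcs G \<Longrightarrow> w \<in> pverts G"
    "(u, w) \<in> parcs G \<longleftrightarrow> (w, u) \<in> parcs G" "(u, u) \<notin> parcs G"
proof -
  interpret pair_graph G by fact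
  show "finite (pverts G)" by (rule pair_finite_verts)
  show "(u, w) \<in> parcs G \<Longrightarrow> u \<in> pverts G" "(u, w) \<in> parcs G \<Longrightarrow> w \<in> pverts G"
    by (auto dest: in_arcsD1 in_arcsD2)
  show "(u, w) \<in> parcs G \<longleftrightarrow> (w, u) \<in> parcs G"
    using pair_sym_arcs by (auto simp: symmetric_def sym_def)
  show "(u, u) \<notin> parcs G" using no_loops' by blast
qed

lemma clique_polyhedron_remove_vertex:
  assumes G: "pair_graph G" "v \<in> pverts G"
  shows "clique_polyhedron (parcs G) (pverts G) =
      clique_polyhedron (parcs G) (pverts G - {v}) \<union>
      clique_polyhedron (parcs G) (insert v {w \<in> pverts G. (v, w) \<in> parcs G})"
    and "clique_polyhedron (parcs G) (pverts G - {v}) \<inter>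
      clique_polyhedron (parcs G) (insert v {w \<in> pverts G. (v, w) \<in> parcs G}) =
      clique_polyhedron (parcs G) {w \<in> pverts G. (v, w) \<in> parcs G}"
proof -
  note g = pair_graphD[OF G(1)]
  show "clique_polyhedron (parcs G) (pverts G) =
      clique_polyhedron (parcs G) (pverts G - {v}) \<union>
      clique_polyhedron (parcs G) (insert v {w \<in> pverts G. (v, w) \<in> parcs G})"
    by (rule clique_polyhedron_split_vertex[OF G(2)])
  have "(pverts G - {v}) \<inter> insert v {w \<in> pverts G. (v, w) \<in> parcs G} =
      {w \<in> pverts G. (v, w) \<in> parcs G}"
    using g(5) by auto
  then show "clique_polyhedron (parcs G) (pverts G - {v}) \<inter>
      clique_polyhedron (parcs G) (insert v {w \<in> pverts G. (v, w) \<in> parcs G}) =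
      clique_polyhedron (parcs G) {w \<in> pverts G. (v, w) \<in> parcs G}"
    by (simp add: clique_polyhedron_Int)
qed

text \<open>
  The closed star of \<open>v\<close> is the cone over the unit sphere, which is nonempty because absolute extensors are.
\<close>

lemma absolute_extensor_star:
  fixes G :: "nat pair_pre_digraph"
  assumes G: "pair_graph G"
    and S: "absolute_extensor (clique_polyhedron (parcs G) {w \<in> pverts G. (v, w) \<in> parcs G})"
  shows "absolute_extensor
    (clique_polyhedron (parcs G) (insert v {w \<in> pverts G. (v, w) \<in> parcs G}))"
proof -
  let ?W = "{w \<in> pverts G. (v, w) \<in> parcs G}"
  note g = pair_graphD[OF G]
  have "clique_polyhedron (parcs G) (insert v ?W) = cone_over v (clique_polyhedron (parcs G) ?W)"
    using g(4,5) absolute_extensor_nonempty[OF S] by (intro clique_polyhedron_cone) auto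
  moreover have "absolute_extensor (cone_over v (clique_polyhedron (parcs G) ?W))"
    using g(5) by (intro absolute_extensor_cone[OF S])
      (auto intro: clique_polyhedron_coordinates)
  ultimately show ?thesis by simp
qed

lemma absolute_extensor_contractible_graph:
  fixes B :: "nat pair_pre_digraph"
  assumes "contractible_graph B"
  shows "absolute_extensor (clique_polyhedron (parcs B) (pverts B))"
  using assms
proof induction
  case (one_point B)
  then obtain v where v: "pverts B = {v}" "parcs B = {}"
    by (auto simp: complete_digraph_pair_def card_1_singleton_iff)
  have "x \<in> clique_polyhedron {} {v} \<longleftrightarrow> x = (\<lambda>i. if i = v then 1 else 0)" for x :: "nat \<Rightarrow> real"
  proof
    assume "x \<in> clique_polyhedron {} {v}"
    then obtain K where "finite K" "K \<subseteq> {v}" "x \<in> spanned_simplex K"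
      by (rule mem_clique_polyhedronE)
    then show "x = (\<lambda>i. if i = v then 1 else 0)"
      by (cases "K = {}") (auto simp: spanned_simplex_eq subset_singleton_iff)
  next
    assume "x = (\<lambda>i. if i = v then 1 else 0)"
    then show "x \<in> clique_polyhedron {} {v}"
      by (intro mem_clique_polyhedronI[of "{v}"]) (auto simp: spanned_simplex_eq)
  qed
  then have "clique_polyhedron {} {v} = {\<lambda>i. if i = v then 1 else (0::real)}" by blast
  then show ?case by (simp add: v absolute_extensor_singleton)
next
  case (extension B v)
  note B = pair_graphD[OF extension.hyps(1)]
  let ?W = "{w \<in> pverts B. (v, w) \<in> parcs B}"
  let ?P = "clique_polyhedron (parcs B)"
  have sphere: "absolute_extensor (?P ?W)"
    using extension.IH(1) by (simp add: unit_sphere_def clique_polyhedron_induced)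
  have rest: "absolute_extensor (?P (pverts B - {v}))"
    using extension.IH(2) by (simp add: remove_vertex_def clique_polyhedron_induced)
  note split = clique_polyhedron_remove_vertex[OF extension.hyps(1,2)]
  have "absolute_extensor (?P (insert v ?W))"
    by (rule absolute_extensor_star[OF extension.hyps(1) sphere])
  with rest sphere show ?case
    unfolding split(1)
    by (intro absolute_extensor_Un closed_clique_polyhedron) (use B(1) split(2) in auto)
qed

text \<open>
  The star of \<open>v\<close> collapses onto the sphere of \<open>v\<close>, both being absolute extensors; this leaves the
  realization of the graph without \<open>v\<close>.
\<close>

lemma homotopy_equivalent_remove_vertex:
  fixes G :: "nat pair_pre_digraph"
  assumes G: "pair_graph G" "v \<in> pverts G" and sphere: "contractible_graph (unit_sphere G v)"
  shows "whitney_realization G homotopy_equivalent_space whitney_realization (remove_vertex G v)"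
proof -
  let ?W = "{w \<in> pverts G. (v, w) \<in> parcs G}"
  let ?P = "clique_polyhedron (parcs G)"
  note split = clique_polyhedron_remove_vertex[OF G]
  have S: "absolute_extensor (?P ?W)"
    using absolute_extensor_contractible_graph[OF sphere]
    by (simp add: unit_sphere_def clique_polyhedron_induced)
  have "top_of_set (?P (pverts G - {v}) \<union> ?P (insert v ?W)) homotopy_equivalent_space
      top_of_set (?P (pverts G - {v}))"
    by (intro homotopy_equivalent_Un_absolute_extensor closed_clique_polyhedron
        absolute_extensor_star[OF G(1) S])
      (use pair_graphD(1)[OF G(1)] split(2) S in auto)
  then show ?thesis
    by (simp add: whitney_realization_eq_top_of_set split(1) remove_vertex_def clique_polyhedron_induced)
qed

text \<open>This reduces the addition of a vertex to the removal of a vertex from the larger graph.\<close>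

lemma pair_graph_cone_vertex:
  assumes G: "pair_graph G" and W: "W \<subseteq> pverts G" and v: "v \<notin> pverts G"
  shows "pair_graph (cone_vertex G W v)"
    and "unit_sphere (cone_vertex G W v) v = induced G W"
    and "remove_vertex (cone_vertex G W v) v = G"
proof -
  note g = pair_graphD[OF G]
  have fin: "finite W" using W g(1) finite_subset by blast
  have "parcs G \<subseteq> pverts G \<times> pverts G" using g(2,3) by auto
  then have fin_arcs: "finite (parcs G)" using g(1) finite_subset by blast
  show "pair_graph (cone_vertex G W v)"
  proof
    have "(w, u) \<in> parcs (cone_vertex G W v)" if "(u, w) \<in> parcs (cone_vertex G W v)" for u w
      using that g(4)[of u w] by (auto simp: cone_vertex_def)
    then show "symmetric (with_proj (cone_vertex G W v))"
      by (auto simp: symmetric_def sym_def arcs_ends_def arc_to_ends_def)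
  qed (use g(1,2,3,5) fin fin_arcs W v in \<open>auto simp: cone_vertex_def\<close>)
  show "unit_sphere (cone_vertex G W v) v = induced G W"
    using g(2,3,5) W v by (auto simp: unit_sphere_def cone_vertex_def induced_def)
  show "remove_vertex (cone_vertex G W v) v = G"
    using g(2,3,5) W v by (auto simp: remove_vertex_def cone_vertex_def induced_def intro!: pair_pre_digraph.equality)
qed

lemma homotopy_equivalent_homotopy_step:
  fixes G H :: "nat pair_pre_digraph"
  assumes "homotopy_step G H"
  shows "whitney_realization G homotopy_equivalent_space whitney_realization H"
  using assms
proof cases
  case (remove v)
  then show ?thesis using homotopy_equivalent_remove_vertex by simp
next
  case (add W v)
  then show ?thesis
    using homotopy_equivalent_remove_vertex[of "cone_vertex G W v" v]
      pair_graph_cone_vertex[of G W v] homotopy_equivalent_space_sym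
    by (force simp: cone_vertex_def)
qed

section \<open>Isomorphic graphs\<close>

text \<open>
  Pulling coordinates back along \<open>g\<close> is the linear map of realizations that is induced by the
  inverse of \<open>g\<close> on vertices; in this direction it is visibly continuous.
\<close>

definition reindex :: "'b set \<Rightarrow> ('b \<Rightarrow> 'a) \<Rightarrow> ('a \<Rightarrow> real) \<Rightarrow> 'b \<Rightarrow> real" where
  "reindex V g x = (\<lambda>j. if j \<in> V then x (g j) else 0)"

lemma continuous_map_reindex:
  "continuous_map (subtopology (powertop_real UNIV) S) (powertop_real UNIV) (reindex V g)"
  unfolding continuous_map_componentwise_UNIV reindex_def
  by (auto intro!: continuous_map_from_subtopology continuous_map_product_projection)

lemma reindex_clique_polyhedron:
  assumes g: "bij_betw g V' V"
    and arcs: "\<And>u w. u \<in> V' \<Longrightarrow> w \<in> V' \<Longrightarrow> (u, w) \<in> E' \<longleftrightarrow> (g u, g w) \<in> E"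
    and x: "x \<in> clique_polyhedron E V"
  shows "reindex V' g x \<in> clique_polyhedron E' V'"
proof -
  obtain K where K: "finite K" "K \<subseteq> V" "\<forall>u\<in>K. \<forall>w\<in>K. (u, w) \<in> E \<longleftrightarrow> u \<noteq> w" "x \<in> spanned_simplex K"
    using x by (rule mem_clique_polyhedronE)
  define K' where "K' = {j \<in> V'. g j \<in> K}"
  have inj: "inj_on g K'" using g by (auto simp: K'_def bij_betw_def inj_on_def)
  have img: "g ` K' = K" using g K(2) by (auto simp: K'_def bij_betw_def)
  have fin: "finite K'" using inj img K(1) by (metis finite_imageD)
  have "sum (reindex V' g x) K' = (\<Sum>j\<in>K'. x (g j))"
    by (rule sum.cong) (auto simp: reindex_def K'_def)
  also have "\<dots> = sum x K" using sum.reindex[OF inj, of x] img by (simp add: comp_def)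
  finally have "reindex V' g x \<in> spanned_simplex K'"
    using K(1,4) fin by (auto simp: spanned_simplex_eq reindex_def K'_def)
  moreover have "(u, w) \<in> E' \<longleftrightarrow> u \<noteq> w" if "u \<in> K'" "w \<in> K'" for u w
    using that arcs[of u w] K(3) inj_onD[OF inj, of u w] by (auto simp: K'_def)
  ultimately show ?thesis
    using fin by (intro mem_clique_polyhedronI[of K']) (auto simp: K'_def)
qed

lemma homeomorphic_clique_polyhedra:
  assumes f: "bij_betw f V V'"
    and arcs: "\<And>u w. u \<in> V \<Longrightarrow> w \<in> V \<Longrightarrow> (u, w) \<in> E \<longleftrightarrow> (f u, f w) \<in> E'"
  shows "subtopology (powertop_real UNIV) (clique_polyhedron E V) homeomorphic_space
         subtopology (powertop_real UNIV) (clique_polyhedron E' V')"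
proof -
  define g where "g = inv_into V f"
  have g: "bij_betw g V' V" unfolding g_def by (rule bij_betw_inv_into[OF f])
  have gf: "\<And>u. u \<in> V \<Longrightarrow> g (f u) = u" and fg: "\<And>j. j \<in> V' \<Longrightarrow> f (g j) = j"
    using f by (auto simp: g_def bij_betw_inv_into_left bij_betw_inv_into_right)
  have mem: "\<And>u. u \<in> V \<Longrightarrow> f u \<in> V'" "\<And>j. j \<in> V' \<Longrightarrow> g j \<in> V"
    using f g by (auto simp: bij_betw_def)
  have arcs': "(u, w) \<in> E' \<longleftrightarrow> (g u, g w) \<in> E" if "u \<in> V'" "w \<in> V'" for u w
    using arcs[of "g u" "g w"] that by (simp add: fg mem)
  have push: "reindex V' g x \<in> clique_polyhedron E' V'" if "x \<in> clique_polyhedron E V" for x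
    using reindex_clique_polyhedron[OF g arcs' that] .
  have pull: "reindex V f x \<in> clique_polyhedron E V" if "x \<in> clique_polyhedron E' V'" for x
    using reindex_clique_polyhedron[OF f arcs that] .
  have "reindex V f (reindex V' g x) = x" if "x \<in> clique_polyhedron E V" for x
    using clique_polyhedron_coordinates(3)[OF that] by (auto simp: reindex_def gf mem)
  moreover have "reindex V' g (reindex V f x) = x" if "x \<in> clique_polyhedron E' V'" for x
    using clique_polyhedron_coordinates(3)[OF that] by (auto simp: reindex_def fg mem)
  ultimately show ?thesis
    unfolding homeomorphic_space_def homeomorphic_maps_def
    using push pull
    by (intro exI[of _ "reindex V' g"] exI[of _ "reindex V f"])
      (auto simp: continuous_map_in_subtopology continuous_map_reindex)
qed

text \<open>
  An isomorphism of digraphs has separate maps on vertices and on arcs. For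
  graphs whose arcs are pairs of vertices, the second is determined by the first.
\<close>

lemma homeomorphic_whitney_realization:
  assumes "digraph_iso (with_proj A) (with_proj B)"
  shows "whitney_realization A homeomorphic_space whitney_realization B"
proof -
  obtain h where h: "pre_digraph.digraph_isomorphism (with_proj A) h"
    and B: "with_proj B = app_iso h (with_proj A)"
    using assms unfolding digraph_iso_def by blast
  have wf: "pair_wf_digraph A"
    using h by (simp add: pre_digraph.digraph_isomorphism_def wf_digraph_wp_iff)
  let ?f = "iso_verts h"
  have inj: "inj_on ?f (pverts A)"
    using h by (simp add: pre_digraph.digraph_isomorphism_def)
  have ends: "iso_arcs h (u, w) = (?f u, ?f w)" if "(u, w) \<in> parcs A" for u w
  proof -
    have "iso_tail h = fst" "iso_head h = snd"
      using B by (simp_all add: with_proj_def app_iso_def)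
    then show ?thesis
      using h that by (force simp: pre_digraph.digraph_isomorphism_def prod_eq_iff)
  qed
  have V: "pverts B = ?f ` pverts A" and arcs: "parcs B = iso_arcs h ` parcs A"
    using B by (simp_all add: with_proj_def app_iso_def)
  have "(u, w) \<in> parcs A \<longleftrightarrow> (?f u, ?f w) \<in> parcs B" if "u \<in> pverts A" "w \<in> pverts A" for u w
  proof
    assume "(u, w) \<in> parcs A"
    then show "(?f u, ?f w) \<in> parcs B" unfolding arcs by (metis ends imageI)
  next
    assume "(?f u, ?f w) \<in> parcs B"
    then obtain u' w' where e: "(u', w') \<in> parcs A" "(?f u, ?f w) = iso_arcs h (u', w')"
      unfolding arcs by auto
    then have "u = u'" "w = w'"
      using ends[OF e(1)] inj that pair_wf_digraph.in_arcsD1[OF wf e(1)]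
        pair_wf_digraph.in_arcsD2[OF wf e(1)] by (auto dest: inj_onD)
    with e show "(u, w) \<in> parcs A" by simp
  qed
  then show ?thesis
    unfolding whitney_realization_eq
    by (intro homeomorphic_clique_polyhedra) (use inj V in \<open>auto simp: bij_betw_def\<close>)
qed

theorem theorem3:
  fixes A :: "'a pair_pre_digraph" and B :: "'b pair_pre_digraph"
  assumes "pair_graph A" and "pair_graph B"
    and "graph_homotopic A B"
  shows "whitney_realization A homotopy_equivalent_space whitney_realization B"
proof -
  obtain G H :: "nat pair_pre_digraph" where
    AG: "digraph_iso (with_proj A) (with_proj G)" and GH: "homotopy_step\<^sup>*\<^sup>* G H"
    and HB: "digraph_iso (with_proj H) (with_proj B)"
    using assms(3) unfolding graph_homotopic_def by blast
  from GH have "whitney_realization G homotopy_equivalent_space whitney_realization H"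
  proof induction
    case base
    show ?case by (rule homotopy_equivalent_space_refl)
  next
    case (step H H')
    then show ?case
      using homotopy_equivalent_homotopy_step homotopy_eqv_trans by blast
  qed
  with AG HB show ?thesis
    by (meson homeomorphic_imp_homotopy_equivalent_space homeomorphic_whitney_realization
        homotopy_eqv_trans)
qed

end
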